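(* Let $\alpha\in(1,2]$, $\sigma>0$, $u>0$, $S>0$, $K>0$, $r\in\mathbb{R}$, $\tau>0$, let $X_t\sim L(0,\sigma^\alpha,-1)$, and put $\mu=\sigma^\alpha/\cos\frac{\pi\alpha}{2}$ and $k_u:=\log\frac{S}{K^{1/u}}+r\tau$. The value of the digital power cash-or-nothing call option, i.e. the option with payoff $\mathcal{P}^{(C/N)}(S_T,K)=\mathbf{1}_{\{S_T^u-K>0\}}$, is $$C_\alpha^{(C/N)}(S,K,r,\mu,\tau)=\frac{e^{-r\tau}}{\alpha}\sum_{n=0}^\infty\frac{1}{n!\,\Gamma\left(1-\frac{n}{\alpha}\right)}\,(k_u+\mu\tau)^n\,(-\mu\tau)^{-\frac{n}{\alpha}}.$$
   Context: The process $X_t\sim L(0,\sigma^\alpha,-1)$ is the spectrally negative $\alpha$-stable Lévy process with characteristic function $\mathbb{E}[e^{ikX_t}]=\exp\left(-t\,\sigma^\alpha|k|^\alpha\left(1+i\tan\frac{\alpha\pi}{2}\,\mathrm{sgn}\,k\right)\right)$ for $k\in\mathbb{R}$; equivalently $\mathbb{E}[e^{pX_t}]=e^{-\mu t p^\alpha}$ for $p>0$, with $\mu=\sigma^\alpha/\cos\frac{\pi\alpha}{2}<0$. The asset price at maturity is $S_T=S\,e^{(r+\mu)\tau+X_\tau}$, where $\tau$ is the time-to-maturity, and the value of an option with payoff $\mathcal{P}(S_T,K)$ is $e^{-r\tau}\,\mathbb{E}\left[\mathcal{P}\left(Se^{(r+\mu)\tau+X_\tau},K\right)\right]$. Conventions: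 $1/\Gamma(z)=0$ when $z$ is a non-positive integer, and $0^0=1$. *)

theory Defs
  imports "HOL-Probability.Probability"
begin

text \<open>
  Real-valued Levy processes on the time set \<open>[0, \<infinity>)\<close>, in the usual formulation with stochastic
  continuity instead of regularity of the paths. Values at negative times are unconstrained.
\<close>

definition levy_process :: "'a measure \<Rightarrow> (real \<Rightarrow> 'a \<Rightarrow> real) \<Rightarrow> bool" where
  "levy_process M X \<longleftrightarrow>
     prob_space M \<and>
     (\<forall>t\<ge>0. X t \<in> borel_measurable M) \<and>
     (AE \<omega> in M. X 0 \<omega> = 0) \<and>
     (\<forall>(n::nat) (t :: nat \<Rightarrow> real). 0 \<le> t 0 \<and> strict_mono_on {..n} t \<longrightarrow>
        prob_space.indep_vars M (\<lambda>_. borel) (\<lambda>i \<omega>. X (t (Suc i)) \<omega> - X (t i) \<omega>) {..<n}) \<and>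
     (\<forall>s t. 0 \<le> s \<and> s < t \<longrightarrow>
        distr M borel (\<lambda>\<omega>. X t \<omega> - X s \<omega>) = distr M borel (\<lambda>\<omega>. X (t - s) \<omega> - X 0 \<omega>)) \<and>
     (\<forall>s\<ge>0. \<forall>\<epsilon>>0.
        ((\<lambda>t. measure M {\<omega> \<in> space M. \<bar>X t \<omega> - X s \<omega>\<bar> > \<epsilon>}) \<longlongrightarrow> 0) (at s within {0..}))"

text \<open>
  The process \<open>L(0, \<sigma>\<^sup>\<alpha>, -1)\<close>: location 0 and skewness \<open>-1\<close>. The scale is normalised so that for
  \<open>\<alpha> = 2\<close> this is Brownian motion with variance \<open>2 \<sigma>\<^sup>2 t\<close> at time \<open>t\<close>.
\<close>

definition spectrally_negative_stable_process ::
    "'a measure \<Rightarrow> real \<Rightarrow> real \<Rightarrow> (real \<Rightarrow> 'a \<Rightarrow> real) \<Rightarrow> bool" where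
  "spectrally_negative_stable_process M \<alpha> \<sigma> X \<longleftrightarrow>
     levy_process M X \<and>
     (\<forall>t\<ge>0. \<forall>k. char (distr M borel (X t)) k =
        exp (- complex_of_real (t * \<sigma> powr \<alpha> * \<bar>k\<bar> powr \<alpha>) *
             (1 + \<i> * complex_of_real (tan (\<alpha> * pi / 2) * sgn k))))"

definition terminal_price ::
    "(real \<Rightarrow> 'a \<Rightarrow> real) \<Rightarrow> real \<Rightarrow> real \<Rightarrow> real \<Rightarrow> real \<Rightarrow> 'a \<Rightarrow> real" where
  "terminal_price X S r \<mu> \<tau> \<omega> = S * exp ((r + \<mu>) * \<tau> + X \<tau> \<omega>)"

definition option_value ::
    "'a measure \<Rightarrow> (real \<Rightarrow> 'a \<Rightarrow> real) \<Rightarrow> (real \<Rightarrow> real \<Rightarrow> real) \<Rightarrow>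
     real \<Rightarrow> real \<Rightarrow> real \<Rightarrow> real \<Rightarrow> real \<Rightarrow> real" where
  "option_value M X P S K r \<mu> \<tau> =
     exp (- r * \<tau>) * prob_space.expectation M (\<lambda>\<omega>. P (terminal_price X S r \<mu> \<tau> \<omega>) K)"

definition digital_power_cash_or_nothing_call :: "real \<Rightarrow> real \<Rightarrow> real \<Rightarrow> real" where
  "digital_power_cash_or_nothing_call u s K = (if s powr u - K > 0 then 1 else 0)"

end

(* The payoff is the indicator of the event X_tau > - y with y = k_u + mu tau, so the value is a discounted
   tail probability of a stable law. For t > 0 its characteristic function is exp (- s t^alpha), where
   s = (- mu tau) exp (i (pi alpha / 2 - pi)) lies in the open right half plane. Gil-Pelaez inversion
   turns the tail into the integral of Im (exp (i t y - s t^alpha)) / t over t > 0, and since alpha > 1 the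
   factor exp (i t y) may be expanded and integrated termwise. The n-th term is a Mellin transform
   equal to Gamma (n/alpha) / alpha * s^(- n/alpha), by analytic continuation in s from the positive reals;
   the reflection formula yields 1 / Gamma (1 - n/alpha), and the term n = 0, which is - Arg s / alpha,
   arises as the limit of vanishing exponent. *)
theory Submission
  imports Defs "HOL-Complex_Analysis.Complex_Analysis"
begin

section \<open>Mellin transforms of exponentials of powers\<close>

text \<open>The substitution \<open>v = \<kappa> * t powr \<alpha>\<close> turns Euler's integral
  for \<open>Gamma (q / \<alpha>)\<close> into a constant multiple of this one.\<close>

lemma
  fixes \<alpha> q \<kappa> :: real
  assumes "\<alpha> > 0" "q > 0" "\<kappa> > 0"
  shows set_integrable_powr_exp_powr:
      "set_integrable lborel {0<..} (\<lambda>t. t powr (q - 1) * exp (- \<kappa> * t powr \<alpha>))" (is ?int)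
    and set_integral_powr_exp_powr:
      "(LBINT t:{0<..}. t powr (q - 1) * exp (- \<kappa> * t powr \<alpha>))
         = Gamma (q / \<alpha>) / \<alpha> * \<kappa> powr (- q / \<alpha>)" (is ?eq)
proof -
  define f where "f = (\<lambda>v::real. v powr (q / \<alpha> - 1) / exp v)"
  define g where "g = (\<lambda>t::real. \<kappa> * t powr \<alpha>)"
  define g' where "g' = (\<lambda>t::real. \<kappa> * (\<alpha> * t powr (\<alpha> - 1)))"
  define h where "h = (\<lambda>t::real. t powr (q - 1) * exp (- \<kappa> * t powr \<alpha>))"
  have q\<alpha>: "q / \<alpha> > 0" using assms by simp
  have "(f has_integral Gamma (q / \<alpha>)) {0..}"
    unfolding f_def by (rule Gamma_integral_real[OF q\<alpha>])
  \<comment> \<open>The null set \<open>{0}\<close> is discarded, so that \<open>g\<close> maps the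
    open half-line bijectively onto itself.\<close>
  hence "((\<lambda>v. if v \<in> {0<..} then f v else 0) has_integral Gamma (q / \<alpha>)) {0..}"
    by (rule has_integral_spike [of "{0}", rotated 2]) auto
  hence f_int: "(f has_integral Gamma (q / \<alpha>)) {0<..}"
    by (subst (asm) has_integral_restrict) auto
  have f_abs: "f absolutely_integrable_on {0<..}"
    by (rule nonnegative_absolutely_integrable_1) (use f_int in \<open>auto simp: f_def\<close>)
  have inj: "inj_on g {0<..}"
    unfolding g_def using assms
    by (intro inj_onI) (metis greaterThan_iff less_eq_real_def mult_cancel_left neq_iff powr_less_mono2)
  have img: "g ` {0<..} = {0<..}"
  proof (intro equalityI subsetI)
    fix v :: real assume v: "v \<in> {0<..}"
    have "v = g ((v / \<kappa>) powr (1 / \<alpha>))"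
      using v assms by (simp add: g_def powr_powr)
    moreover have "(v / \<kappa>) powr (1 / \<alpha>) \<in> {0<..}" using v assms by simp
    ultimately show "v \<in> g ` {0<..}" by blast
  qed (use assms in \<open>auto simp: g_def\<close>)
  have der: "(g has_field_derivative g' t) (at t within {0<..})" if "t \<in> {0<..}" for t
    using that unfolding g_def g'_def by (auto intro!: derivative_eq_intros)
  \<comment> \<open>The Jacobian absorbs the difference of the exponents: the pulled-back Gamma
    integrand is a constant times \<open>h\<close>.\<close>
  have eq: "\<bar>g' t\<bar> * f (g t) = \<alpha> * \<kappa> powr (q / \<alpha>) * h t" if "t \<in> {0<..}" for t
  proof -
    have t: "t > 0" using that by simp
    have "(\<kappa> * t powr \<alpha>) powr (q / \<alpha> - 1) = \<kappa> powr (q / \<alpha>) / \<kappa> * t powr (q - \<alpha>)"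
      using assms t by (simp add: powr_mult powr_powr powr_diff right_diff_distrib)
    moreover have "t powr (\<alpha> - 1) * t powr (q - \<alpha>) = t powr (q - 1)"
      by (simp flip: powr_add)
    moreover have "\<bar>g' t\<bar> = g' t" using assms t by (simp add: g'_def)
    moreover have "\<kappa> * \<alpha> * A * (B / \<kappa> * C / E) = \<alpha> * B * (A * C * inverse E)" for A B C E :: real
      using assms by (simp add: field_simps)
    ultimately show ?thesis
      by (simp add: g'_def g_def f_def h_def exp_minus mult.assoc)
  qed
  have "(\<lambda>t. \<bar>g' t\<bar> * f (g t)) absolutely_integrable_on {0<..} \<and>
        integral {0<..} (\<lambda>t. \<bar>g' t\<bar> * f (g t)) = Gamma (q / \<alpha>)"
    using has_absolute_integral_change_of_variables_1'[of "{0<..}" g g' f "Gamma (q/\<alpha>)"]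
      inj der f_abs f_int img by (auto simp: integral_unique)
  moreover have "(\<lambda>t. \<bar>g' t\<bar> * f (g t)) absolutely_integrable_on {0<..} \<longleftrightarrow>
      (\<lambda>t. \<alpha> * \<kappa> powr (q / \<alpha>) * h t) absolutely_integrable_on {0<..}"
    by (intro set_integrable_cong) (use eq in auto)
  moreover have "integral {0<..} (\<lambda>t. \<bar>g' t\<bar> * f (g t)) =
      integral {0<..} (\<lambda>t. \<alpha> * \<kappa> powr (q / \<alpha>) * h t)"
    by (intro integral_cong) (use eq in auto)
  ultimately have *: "(\<lambda>t. \<alpha> * \<kappa> powr (q / \<alpha>) * h t) absolutely_integrable_on {0<..}"
      "\<alpha> * \<kappa> powr (q / \<alpha>) * integral {0<..} h = Gamma (q / \<alpha>)"
    by auto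
  have habs: "h absolutely_integrable_on {0<..}"
    using set_integrable_mult_right[OF *(1), of "inverse (\<alpha> * \<kappa> powr (q / \<alpha>))"] assms by auto
  \<comment> \<open>Change of variables yields integrability for the completed measure; Borel
    measurability of \<open>h\<close> transfers it to \<open>lborel\<close>.\<close>
  have meas: "set_borel_measurable borel {0<..} h"
    unfolding h_def set_borel_measurable_def by measurable
  show int: ?int
    using habs meas unfolding h_def[symmetric] set_integrable_def set_borel_measurable_def
    by (subst (asm) integrable_completion) auto
  have "(LBINT t:{0<..}. h t) = integral {0<..} h"
    using int unfolding h_def[symmetric] by (rule set_borel_integral_eq_integral(2))
  thus ?eq using *(2) assms unfolding h_def[symmetric] by (simp add: powr_minus field_simps)
qed

text \<open>This is the Mellin transform at \<open>q\<close> of the map from \<open>t\<close> to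
  \<open>exp (- s * t powr \<alpha>)\<close>. The complex parameter \<open>s\<close> comes last so
  that \<open>mellin_exp \<alpha> q\<close> is the function to be continued analytically.\<close>

definition mellin_exp :: "real \<Rightarrow> real \<Rightarrow> complex \<Rightarrow> complex" where
  "mellin_exp \<alpha> q s = (LBINT t:{0<..}. of_real (t powr (q - 1)) * exp (- s * of_real (t powr \<alpha>)))"

lemma set_integrable_powr_cexp_powr:
  fixes \<alpha> q :: real and s :: complex
  assumes "\<alpha> > 0" "q > 0" "Re s > 0"
  shows "set_integrable lborel {0<..} (\<lambda>t. of_real (t powr (q - 1)) * exp (- s * of_real (t powr \<alpha>)))"
proof (rule set_integrable_bound[OF set_integrable_powr_exp_powr[OF assms]])
  show "set_borel_measurable lborel {0<..}
     (\<lambda>t. complex_of_real (t powr (q - 1)) * exp (- s * complex_of_real (t powr \<alpha>)))"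
    unfolding set_borel_measurable_def by measurable
qed (auto simp: norm_mult)

text \<open>Differentiation under the integral brings down a factor
  \<open>- (t powr \<alpha>)\<close>, which shifts \<open>q\<close> by \<alpha>. The limit is taken
  along sequences so that dominated convergence applies.\<close>

lemma mellin_exp_has_field_derivative:
  fixes \<alpha> q :: real and s :: complex
  assumes "\<alpha> > 0" "q > 0" "Re s > 0"
  shows "(mellin_exp \<alpha> q has_field_derivative - mellin_exp \<alpha> (q + \<alpha>) s) (at s)"
  unfolding has_field_derivative_iff tendsto_at_iff_sequentially comp_def
proof (intro allI impI)
  fix z :: "nat \<Rightarrow> complex"
  assume z: "\<forall>i. z i \<in> UNIV - {s}" "z \<longlonglongrightarrow> s"
  \<comment> \<open>Within distance \<open>Re s / 2\<close> of \<open>s\<close>, the point stays in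
    the right half-plane, and half of the decay of \<open>exp (- Re s * v)\<close> survives to
    dominate the difference quotients.\<close>
  define \<kappa> where "\<kappa> = Re s / 2"
  have \<kappa>: "\<kappa> > 0" using assms by (simp add: \<kappa>_def)
  define f :: "complex \<Rightarrow> real \<Rightarrow> complex"
    where "f = (\<lambda>w t. of_real (t powr (q - 1)) * exp (- w * of_real (t powr \<alpha>)))"
  define d where "d = (\<lambda>n t. (f (z n) t - f s t) / (z n - s))"
  define d' where "d' = (\<lambda>t. - (of_real (t powr (q + \<alpha> - 1)) * exp (- s * of_real (t powr \<alpha>))) :: complex)"
  have ev: "\<forall>\<^sub>F n in sequentially. dist (z n) s < \<kappa>"
    using z(2) \<kappa> by (rule tendstoD)
  \<comment> \<open>The domination holds from \<open>n0\<close> on, so the limit is proved for the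
    shifted sequence and the shift is undone at the end.\<close>
  then obtain n0 where n0: "\<And>n. n \<ge> n0 \<Longrightarrow> cmod (z n - s) < \<kappa>"
    by (auto simp: eventually_sequentially dist_norm)
  have Re_pos: "Re (z n) > 0" if "n \<ge> n0" for n
    using n0[OF that] abs_Re_le_cmod[of "z n - s"] by (auto simp: \<kappa>_def)
  have lim: "(\<lambda>n. LBINT t:{0<..}. d (n + n0) t) \<longlonglongrightarrow> (LBINT t:{0<..}. d' t)"
    unfolding set_lebesgue_integral_def
  proof (rule integral_dominated_convergence)
    show "integrable lborel (\<lambda>t. indicator {0<..} t *\<^sub>R (t powr (q + \<alpha> - 1) * exp (- \<kappa> * t powr \<alpha>)))"
      using set_integrable_powr_exp_powr[of \<alpha> "q + \<alpha>" \<kappa>] assms \<kappa> by (simp add: set_integrable_def)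
    show "AE t in lborel. (\<lambda>n. indicator {0<..} t *\<^sub>R d (n + n0) t) \<longlonglongrightarrow> indicator {0<..} t *\<^sub>R d' t"
    proof (intro AE_I2)
      fix t :: real
      show "(\<lambda>n. indicator {0<..} t *\<^sub>R d (n + n0) t) \<longlonglongrightarrow> indicator {0<..} t *\<^sub>R d' t"
      proof (cases "t > 0")
        case True
        have "((\<lambda>w. f w t) has_field_derivative d' t) (at s)"
          unfolding f_def d'_def
          by (rule derivative_eq_intros refl)+ (use True in \<open>simp add: powr_add powr_diff field_simps\<close>)
        hence "(\<lambda>n. d n t) \<longlonglongrightarrow> d' t"
          using z unfolding has_field_derivative_iff tendsto_at_iff_sequentially comp_def d_def by blast
        thus ?thesis by (intro tendsto_intros LIMSEQ_ignore_initial_segment)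
      qed auto
    qed
    show "AE t in lborel. norm (indicator {0<..} t *\<^sub>R d (n + n0) t) \<le>
        indicator {0<..} t *\<^sub>R (t powr (q + \<alpha> - 1) * exp (- \<kappa> * t powr \<alpha>))" for n
    proof (intro AE_I2)
      fix t :: real
      show "norm (indicator {0<..} t *\<^sub>R d (n + n0) t) \<le>
        indicator {0<..} t *\<^sub>R (t powr (q + \<alpha> - 1) * exp (- \<kappa> * t powr \<alpha>))"
      proof (cases "t > 0")
        case True
        define v where "v = t powr \<alpha>"
        define \<delta> where "\<delta> = z (n + n0) - s"
        have v: "v > 0" using True by (simp add: v_def)
        have \<delta>: "cmod \<delta> < \<kappa>" "\<delta> \<noteq> 0" using n0[of "n + n0"] z(1) by (auto simp: \<delta>_def)
        have "f (z (n + n0)) t - f s t =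
            of_real (t powr (q - 1)) * exp (- s * of_real v) * (exp (- \<delta> * of_real v) - 1)"
          by (simp add: f_def v_def \<delta>_def algebra_simps flip: exp_add)
        \<comment> \<open>This is the order-zero Taylor remainder of the exponential. The factor
          \<open>cmod \<delta>\<close> cancels the denominator of the quotient.\<close>
        moreover have "cmod (exp (- \<delta> * of_real v) - 1) \<le> exp (\<kappa> * v) * (cmod \<delta> * v)"
        proof -
          have "cmod (exp (- \<delta> * of_real v) - 1) \<le> exp \<bar>Re (- \<delta> * of_real v)\<bar> * cmod (- \<delta> * of_real v)"
            using Taylor_exp[of "- \<delta> * of_real v" 0] by simp
          also have "\<dots> \<le> exp (\<kappa> * v) * (cmod \<delta> * v)"
          proof (intro mult_mono)
            have "\<bar>Re \<delta>\<bar> * v \<le> \<kappa> * v"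
              using abs_Re_le_cmod[of \<delta>] \<delta> v by (intro mult_right_mono) auto
            thus "exp \<bar>Re (- \<delta> * of_real v)\<bar> \<le> exp (\<kappa> * v)"
              using v by (simp add: abs_mult)
          qed (use v in \<open>auto simp: norm_mult\<close>)
          finally show ?thesis .
        qed
        ultimately have "cmod (f (z (n + n0)) t - f s t) \<le>
            t powr (q - 1) * exp (- Re s * v) * (exp (\<kappa> * v) * (cmod \<delta> * v))"
          by (simp add: norm_mult mult_left_mono)
        also have "\<dots> = t powr (q + \<alpha> - 1) * exp (- \<kappa> * v) * cmod \<delta>"
        proof -
          have "exp (- Re s * v) * exp (\<kappa> * v) = exp (- \<kappa> * v)"
            by (simp add: \<kappa>_def algebra_simps flip: exp_add)
          moreover have "t powr (q - 1) * v = t powr (q + \<alpha> - 1)"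
            unfolding v_def by (simp add: algebra_simps flip: powr_add)
          ultimately show ?thesis by (metis mult.assoc mult.commute)
        qed
        finally show ?thesis
          using \<delta> True by (simp add: d_def norm_divide v_def divide_simps flip: \<delta>_def)
      qed auto
    qed
    show "(\<lambda>t. indicator {0<..} t *\<^sub>R d' t) \<in> borel_measurable lborel"
      unfolding d'_def by measurable
    show "(\<lambda>t. indicator {0<..} t *\<^sub>R d (n + n0) t) \<in> borel_measurable lborel" for n
      unfolding d_def f_def by measurable
  qed
  have "(LBINT t:{0<..}. d (n + n0) t) =
      (mellin_exp \<alpha> q (z (n + n0)) - mellin_exp \<alpha> q s) / (z (n + n0) - s)" for n
    using set_integrable_powr_cexp_powr[of \<alpha> q s] set_integrable_powr_cexp_powr[of \<alpha> q "z (n + n0)"]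
      Re_pos[of "n + n0"] assms
    unfolding d_def mellin_exp_def f_def by (simp add: set_integral_diff)
  moreover have "(LBINT t:{0<..}. d' t) = - mellin_exp \<alpha> (q + \<alpha>) s"
    unfolding d'_def mellin_exp_def by (simp add: set_lebesgue_integral_def)
  ultimately show "(\<lambda>n. (mellin_exp \<alpha> q (z n) - mellin_exp \<alpha> q s) / (z n - s))
      \<longlonglongrightarrow> - mellin_exp \<alpha> (q + \<alpha>) s"
    using lim LIMSEQ_offset[where k = n0] by force
qed

text \<open>Both sides are holomorphic in \<open>s\<close> on the right half-plane, which avoids the
  branch cut of the power, and they agree on the positive reals by the real integral. The identity
  theorem applies because these accumulate at 1.\<close>

lemma mellin_exp_eq:
  fixes \<alpha> q :: real and s :: complex
  assumes "\<alpha> > 0" "q > 0" "Re s > 0"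
  shows "mellin_exp \<alpha> q s = of_real (Gamma (q / \<alpha>) / \<alpha>) * s powr of_real (- q / \<alpha>)"
proof -
  define H where "H = {w. 0 < Re w}"
  define U where "U = complex_of_real ` {0<..}"
  define D where "D = (\<lambda>w. mellin_exp \<alpha> q w - of_real (Gamma (q / \<alpha>) / \<alpha>) * w powr of_real (- q / \<alpha>))"
  have "D s = 0"
  proof (rule analytic_continuation[where f = D and w = s and S = H and U = U and \<xi> = 1])
    show "D holomorphic_on H"
      unfolding D_def
    proof (intro holomorphic_intros)
      show "mellin_exp \<alpha> q holomorphic_on H"
        using mellin_exp_has_field_derivative[OF assms(1,2)]
        by (subst holomorphic_on_open) (auto simp: H_def open_halfspace_Re_gt)
    qed (auto simp: H_def complex_nonpos_Reals_iff)
    show "open H" "connected H"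
      by (auto simp: H_def open_halfspace_Re_gt convex_connected convex_halfspace_Re_gt)
    show "U \<subseteq> H" "1 \<in> H" "s \<in> H" using assms by (auto simp: H_def U_def)
    have "(1::real) islimpt {0<..}"
      by (rule interior_limit_point) (auto simp: interior_open)
    thus "1 islimpt U"
      unfolding U_def using islimpt_isCont_image[of 1 "{0<..}" complex_of_real]
      by (auto simp: eventually_at_filter)
    show "D z = 0" if "z \<in> U" for z
    proof -
      obtain r where "r \<in> {0<..}" and r: "z = of_real r"
        using \<open>z \<in> U\<close> unfolding U_def by (rule imageE)
      hence "r > 0" by simp
      have "mellin_exp \<alpha> q z = of_real (LBINT t:{0<..}. t powr (q - 1) * exp (- r * t powr \<alpha>))"
      proof -
        have "of_real (t powr (q - 1)) * exp (- z * of_real (t powr \<alpha>)) =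
            complex_of_real (t powr (q - 1) * exp (- r * t powr \<alpha>))" for t
          unfolding r by (simp flip: exp_of_real)
        thus ?thesis
          unfolding mellin_exp_def by (simp only: set_integral_complex_of_real)
      qed
      also have "\<dots> = of_real (Gamma (q / \<alpha>) / \<alpha> * r powr (- q / \<alpha>))"
        using set_integral_powr_exp_powr[OF assms(1,2) \<open>r > 0\<close>] by simp
      finally have "mellin_exp \<alpha> q z = of_real (Gamma (q / \<alpha>) / \<alpha> * r powr (- q / \<alpha>))" .
      moreover have "z powr of_real (- q / \<alpha>) = of_real (r powr (- q / \<alpha>))"
        unfolding r using \<open>r > 0\<close> by (intro powr_of_real) simp
      ultimately show ?thesis
        by (simp only: D_def of_real_mult diff_self)
    qed
  qed
  thus ?thesis by (simp add: D_def)
qed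

section \<open>Dirichlet integrals and Gil-Pelaez inversion\<close>

text \<open>Rescaling by \<open>\<bar>\<theta>\<bar>\<close> expresses the integral through two
  values of the sine integral \<open>Si\<close>, which is bounded and tends to
  \<open>pi / 2\<close>. The bound is uniform in \<open>n\<close> and \<theta>, as needed to pass to
  the limit under an expectation.\<close>

lemma set_integral_sin_divide_tendsto:
  fixes \<theta> :: real
  shows "(\<lambda>n. LBINT t:{1 / real (Suc n)..real (Suc n)}. sin (t * \<theta>) / t) \<longlonglongrightarrow> sgn \<theta> * (pi / 2)"
    and "\<exists>B. \<forall>n \<theta>. \<bar>LBINT t:{1 / real (Suc n)..real (Suc n)}. sin (t * \<theta>) / t\<bar> \<le> B"
proof -
  have eq: "(LBINT t:{1 / real (Suc n)..real (Suc n)}. sin (t * \<theta>) / t) =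
      sgn \<theta> * (Si (real (Suc n) * \<bar>\<theta>\<bar>) - Si (1 / real (Suc n) * \<bar>\<theta>\<bar>))" for n \<theta>
  proof -
    define a b where "a = 1 / real (Suc n)" and "b = real (Suc n)"
    have "1 / real (Suc n) \<le> 1" by simp
    also have "1 \<le> real (Suc n)" by simp
    finally have ab: "0 < a" "a \<le> b" by (auto simp: a_def b_def)
    \<comment> \<open>Splitting at \<open>a\<close> makes the truncated integral a difference of
      integrals from 0, each a value of \<open>Si\<close> up to sign.\<close>
    have "(LBINT t=0..a. sin (t * \<theta>) / t) + (LBINT t=a..b. sin (t * \<theta>) / t) =
        (LBINT t=0..b. sin (t * \<theta>) / t)"
    proof (rule interval_integral_sum)
      have "interval_lebesgue_integrable lborel (ereal 0) (ereal b) (\<lambda>t. sin (t * \<theta>) / t)"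
        using integrable_sinc'[of b \<theta>] ab by (simp add: interval_lebesgue_integrable_def zero_ereal_def)
      thus "interval_lebesgue_integrable lborel (min 0 (min (ereal a) (ereal b)))
          (max 0 (max (ereal a) (ereal b))) (\<lambda>t. sin (t * \<theta>) / t)"
        using ab by (simp add: min_def max_def zero_ereal_def)
    qed
    moreover have "(LBINT t=a..b. sin (t * \<theta>) / t) = (LBINT t:{a..b}. sin (t * \<theta>) / t)"
      by (rule interval_integral_Icc[OF ab(2)])
    moreover have "(LBINT t=0..a. sin (t * \<theta>) / t) = sgn \<theta> * Si (a * \<bar>\<theta>\<bar>)"
      "(LBINT t=0..b. sin (t * \<theta>) / t) = sgn \<theta> * Si (b * \<bar>\<theta>\<bar>)"
      using LBINT_I0c_sin_scale_divide[of a \<theta>] LBINT_I0c_sin_scale_divide[of b \<theta>] ab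
      by (auto simp: zero_ereal_def)
    ultimately show ?thesis by (simp add: a_def b_def algebra_simps)
  qed
  show "(\<lambda>n. LBINT t:{1 / real (Suc n)..real (Suc n)}. sin (t * \<theta>) / t) \<longlonglongrightarrow> sgn \<theta> * (pi / 2)"
  proof (cases "\<theta> = 0")
    case False
    have "filterlim (\<lambda>n. real (Suc n) * \<bar>\<theta>\<bar>) at_top sequentially"
      using False by (intro filterlim_at_top_mult_tendsto_pos[OF tendsto_const]
          filterlim_compose[OF filterlim_real_sequentially filterlim_Suc]) auto
    hence 1: "(\<lambda>n. Si (real (Suc n) * \<bar>\<theta>\<bar>)) \<longlonglongrightarrow> pi / 2"
      by (rule filterlim_compose[OF Si_at_top])
    have "(\<lambda>n. 1 / real (Suc n) * \<bar>\<theta>\<bar>) \<longlonglongrightarrow> 0 * \<bar>\<theta>\<bar>"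
      using LIMSEQ_inverse_real_of_nat by (intro tendsto_intros) (simp add: inverse_eq_divide)
    hence "(\<lambda>n. Si (1 / real (Suc n) * \<bar>\<theta>\<bar>)) \<longlonglongrightarrow> Si (0 * \<bar>\<theta>\<bar>)"
      by (rule isCont_tendsto_compose[OF isCont_Si])
    hence 2: "(\<lambda>n. Si (1 / real (Suc n) * \<bar>\<theta>\<bar>)) \<longlonglongrightarrow> 0"
      by (simp add: Si_alt_def zero_ereal_def)
    show ?thesis unfolding eq using tendsto_mult[OF tendsto_const tendsto_diff[OF 1 2], of "sgn \<theta>"] by simp
  qed simp
  obtain B where B: "\<And>T. \<bar>Si T\<bar> \<le> B" using bounded_Si by blast
  have "\<bar>LBINT t:{1 / real (Suc n)..real (Suc n)}. sin (t * \<theta>) / t\<bar> \<le> 2 * B" for n \<theta>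
  proof -
    have B0: "0 \<le> B" using B[of 0] by linarith
    have "\<bar>sgn \<theta>\<bar> \<le> 1" by (simp add: sgn_if)
    moreover have "\<bar>Si (real (Suc n) * \<bar>\<theta>\<bar>) - Si (1 / real (Suc n) * \<bar>\<theta>\<bar>)\<bar> \<le> 2 * B"
      using B[of "real (Suc n) * \<bar>\<theta>\<bar>"] B[of "1 / real (Suc n) * \<bar>\<theta>\<bar>"] by linarith
    ultimately show ?thesis unfolding eq abs_mult
      using mult_mono[of "\<bar>sgn \<theta>\<bar>" 1 "\<bar>Si (real (Suc n) * \<bar>\<theta>\<bar>) - Si (1 / real (Suc n) * \<bar>\<theta>\<bar>)\<bar>" "2 * B"] B0
      by simp
  qed
  thus "\<exists>B. \<forall>n \<theta>. \<bar>LBINT t:{1 / real (Suc n)..real (Suc n)}. sin (t * \<theta>) / t\<bar> \<le> B" by blast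
qed

text \<open>The factor \<open>iexp (- (t * a))\<close> recentres the distribution at
  \<open>a\<close>; taking imaginary parts under the integral leaves the sine that enters the
  Dirichlet integral.\<close>

lemma (in real_distribution) Im_iexp_char:
  "Im (iexp (- (t * a)) * char M t) = (\<integral>x. sin (t * (x - a)) \<partial>M)"
proof -
  have "integrable M (\<lambda>x. iexp (t * x))"
    by (rule integrable_iexp) auto
  hence int: "integrable M (\<lambda>x. iexp (- (t * a)) * iexp (t * x))" by simp
  have "iexp (- (t * a)) * char M t = (\<integral>x. iexp (- (t * a)) * iexp (t * x) \<partial>M)"
    unfolding char_def by simp
  hence "Im (iexp (- (t * a)) * char M t) = (\<integral>x. Im (iexp (- (t * a)) * iexp (t * x)) \<partial>M)"
    using integral_Im[OF int] by simp
  also have "\<dots> = (\<integral>x. sin (t * (x - a)) \<partial>M)"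
  proof (rule Bochner_Integration.integral_cong[OF refl])
    fix x :: real
    have "iexp (- (t * a)) * iexp (t * x) = iexp (t * (x - a))"
      by (simp add: exp_add[symmetric] algebra_simps)
    thus "Im (iexp (- (t * a)) * iexp (t * x)) = sin (t * (x - a))"
      by (simp add: Im_exp)
  qed
  finally show ?thesis .
qed

text \<open>Fubini's theorem applies since \<open>1 / t\<close> is at most
  \<open>1 / \<epsilon>\<close> on the truncated range and the product measure of the strip is
  finite.\<close>

lemma (in real_distribution) truncated_gil_pelaez:
  fixes a \<epsilon> T :: real
  assumes "0 < \<epsilon>"
  shows "(LBINT t:{\<epsilon>..T}. Im (iexp (- (t * a)) * char M t) / t) =
           (\<integral>x. (LBINT t:{\<epsilon>..T}. sin (t * (x - a)) / t) \<partial>M)"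
proof -
  interpret P: pair_sigma_finite lborel M ..
  define f where "f = (\<lambda>(t, x). indicator {\<epsilon>..T} t * (sin (t * (x - a)) / t))"
  have "integrable (lborel \<Otimes>\<^sub>M M) f"
  proof (rule Bochner_Integration.integrable_bound)
    show "integrable (lborel \<Otimes>\<^sub>M M) (\<lambda>z. indicator ({\<epsilon>..T} \<times> space M) z / \<epsilon>)"
      by (intro integrable_divide integrable_real_indicator)
        (auto simp: emeasure_pair_measure_Times ennreal_mult_eq_top_iff less_top[symmetric] emeasure_lborel_Icc_eq)
    show "f \<in> borel_measurable (lborel \<Otimes>\<^sub>M M)"
      unfolding f_def by measurable
    have "norm (f (t, x)) \<le> norm (indicator ({\<epsilon>..T} \<times> space M) (t, x) / \<epsilon>)" for t x
      using assms abs_sin_le_one[of "t * (x - a)"]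
      by (auto simp: f_def indicator_def intro!: frac_le)
    thus "AE z in lborel \<Otimes>\<^sub>M M. norm (f z) \<le> norm (indicator ({\<epsilon>..T} \<times> space M) z / \<epsilon>)"
      by (intro AE_I2) (auto simp: split_paired_all)
  qed
  from P.Fubini_integral[OF this[unfolded f_def]]
  show ?thesis
    unfolding Im_iexp_char by (simp add: set_lebesgue_integral_def)
qed

text \<open>The truncated integrals have two limits: the full integral, by the assumed
  integrability, and the expectation of \<open>sgn (x - a) * (pi / 2)\<close>, by Fubini and the
  Dirichlet integral. Since \<open>sgn 0 = 0\<close>, an atom at \<open>a\<close> drops out, whence
  the two strict tails.\<close>

theorem (in real_distribution) gil_pelaez:
  fixes a :: real
  assumes int: "set_integrable lborel {0<..} (\<lambda>t. Im (iexp (- (t * a)) * char M t) / t)"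
  shows "prob {a<..} - prob {..<a} = 2 / pi * (LBINT t:{0<..}. Im (iexp (- (t * a)) * char M t) / t)"
proof -
  define f where "f = (\<lambda>t. Im (iexp (- (t * a)) * char M t) / t)"
  define I where "I = (\<lambda>n. {1 / real (Suc n)..real (Suc n)})"
  have "(\<lambda>n. LBINT t:I n. f t) \<longlonglongrightarrow> (LBINT t:{0<..}. f t)"
    unfolding set_lebesgue_integral_def
  proof (rule integral_dominated_convergence)
    show "integrable lborel (\<lambda>t. norm (indicator {0<..} t *\<^sub>R f t))"
      using int unfolding set_integrable_def f_def by (rule integrable_norm)
    show "AE t in lborel. (\<lambda>n. indicator (I n) t *\<^sub>R f t) \<longlonglongrightarrow> indicator {0<..} t *\<^sub>R f t"
    proof (intro AE_I2)
      fix t :: real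
      \<comment> \<open>A fixed positive \<open>t\<close> lies in \<open>I n\<close> once
        \<open>n + 1\<close> exceeds both \<open>t\<close> and \<open>1 / t\<close>; any other
        \<open>t\<close> never does.\<close>
      have "\<forall>\<^sub>F n in sequentially. indicator (I n) t = (indicator {0<..} t :: real)"
      proof (cases "t > 0")
        case True
        have "filterlim (\<lambda>n. real (Suc n)) at_top sequentially"
          by (intro filterlim_compose[OF filterlim_real_sequentially filterlim_Suc])
        hence "\<forall>\<^sub>F n in sequentially. max t (1 / t) \<le> real (Suc n)"
          by (simp only: filterlim_at_top)
        thus ?thesis by eventually_elim (use True in \<open>auto simp: I_def field_simps\<close>)
      next
        case False
        have "t < 1 / real (Suc n)" for n
          using False by (intro le_less_trans[of t 0]) auto
        hence "t \<notin> I n" for n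
          by (metis I_def atLeastAtMost_iff not_le)
        thus ?thesis using False by auto
      qed
      thus "(\<lambda>n. indicator (I n) t *\<^sub>R f t) \<longlonglongrightarrow> indicator {0<..} t *\<^sub>R f t"
        by (intro tendsto_scaleR tendsto_const tendsto_eventually)
    qed
    show "AE t in lborel. norm (indicator (I n) t *\<^sub>R f t) \<le> norm (indicator {0<..} t *\<^sub>R f t)" for n
    proof (intro AE_I2)
      fix t :: real
      have "t \<in> I n \<Longrightarrow> t > 0"
        by (auto simp: I_def intro: less_le_trans[of 0 "1 / real (Suc n)"])
      thus "norm (indicator (I n) t *\<^sub>R f t) \<le> norm (indicator {0<..} t *\<^sub>R f t)"
        by (auto simp: indicator_def)
    qed
    show "(\<lambda>t. indicator {0<..} t *\<^sub>R f t) \<in> borel_measurable lborel"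
         "(\<lambda>t. indicator (I n) t *\<^sub>R f t) \<in> borel_measurable lborel" for n
      unfolding f_def I_def by measurable
  qed
  moreover have "(\<lambda>n. LBINT t:I n. f t) \<longlonglongrightarrow> (\<integral>x. sgn (x - a) * (pi / 2) \<partial>M)"
  proof -
    obtain B where B: "\<And>n \<theta>. \<bar>LBINT t:I n. sin (t * \<theta>) / t\<bar> \<le> B"
      using set_integral_sin_divide_tendsto(2) unfolding I_def by blast
    have "(\<lambda>n. \<integral>x. (LBINT t:I n. sin (t * (x - a)) / t) \<partial>M) \<longlonglongrightarrow> (\<integral>x. sgn (x - a) * (pi / 2) \<partial>M)"
    proof (rule integral_dominated_convergence)
      show "AE x in M. (\<lambda>n. LBINT t:I n. sin (t * (x - a)) / t) \<longlonglongrightarrow> sgn (x - a) * (pi / 2)"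
        unfolding I_def by (intro AE_I2 set_integral_sin_divide_tendsto(1))
      show "AE x in M. norm (LBINT t:I n. sin (t * (x - a)) / t) \<le> B" for n
        using B by auto
      show "(\<lambda>x. LBINT t:I n. sin (t * (x - a)) / t) \<in> borel_measurable M" for n
        unfolding set_lebesgue_integral_def I_def by measurable
    qed auto
    thus ?thesis unfolding f_def I_def by (subst truncated_gil_pelaez) auto
  qed
  ultimately have "(LBINT t:{0<..}. f t) = (\<integral>x. sgn (x - a) * (pi / 2) \<partial>M)"
    by (rule LIMSEQ_unique)
  also have "\<dots> = (\<integral>x. (indicator {a<..} x - indicator {..<a} x) * (pi / 2) \<partial>M)"
    by (intro Bochner_Integration.integral_cong) (auto simp: sgn_if)
  also have "\<dots> = (prob {a<..} - prob {..<a}) * (pi / 2)"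
    by (subst Bochner_Integration.integral_mult_left_zero, subst Bochner_Integration.integral_diff)
      (auto simp: less_top[symmetric])
  finally have "(LBINT t:{0<..}. f t) = (prob {a<..} - prob {..<a}) * (pi / 2)" .
  thus ?thesis unfolding f_def by (simp only:) (simp add: field_simps)
qed

section \<open>The integral of vanishing Mellin exponent\<close>

text \<open>The weight \<open>1 / t\<close> is the limit of \<open>t powr (q - 1)\<close> as
  \<open>q\<close> decreases to 0. There \<open>Gamma (q / \<alpha>)\<close> has a pole, but the
  imaginary part of the power of \<open>s\<close> vanishes to first order, so the limit is
  finite.\<close>

lemma set_integral_Im_cexp_powr_divide:
  fixes \<alpha> :: real and s :: complex
  assumes \<alpha>: "\<alpha> > 0" and s: "Re s > 0"
  shows "set_integrable lborel {0<..} (\<lambda>t. Im (exp (- s * of_real (t powr \<alpha>))) / t)"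
    and "(LBINT t:{0<..}. Im (exp (- s * of_real (t powr \<alpha>))) / t) = - Arg s / \<alpha>"
proof -
  \<comment> \<open>These exponents tend to 0 while staying in the interval from 0 to 1, with 0
    excluded.\<close>
  define p where "p = (\<lambda>k. inverse (real (Suc k)))"
  have p: "0 < p k" "p k \<le> 1" for k by (auto simp: p_def field_simps)
  have p_lim: "filterlim p (at 0) sequentially"
    unfolding filterlim_at p_def using LIMSEQ_inverse_real_of_nat by auto
  define f where "f = (\<lambda>t. Im (exp (- s * of_real (t powr \<alpha>))))"
  define b where "b = (\<lambda>q t. \<bar>Im s\<bar> * (t powr (\<alpha> + q - 1) * exp (- Re s * t powr \<alpha>)))"
  \<comment> \<open>The bound of the sine by its argument supplies a factor
    \<open>t powr \<alpha>\<close>, which beats the singularity of \<open>1 / t\<close> at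
    0.\<close>
  have f_le: "\<bar>f t\<bar> \<le> \<bar>Im s\<bar> * (t powr \<alpha> * exp (- Re s * t powr \<alpha>))" for t
  proof -
    have "\<bar>f t\<bar> = exp (- Re s * t powr \<alpha>) * \<bar>sin (Im s * t powr \<alpha>)\<bar>"
      by (simp add: f_def Im_exp abs_mult)
    also have "\<dots> \<le> exp (- Re s * t powr \<alpha>) * \<bar>Im s * t powr \<alpha>\<bar>"
      by (intro mult_left_mono abs_sin_x_le_abs_x) auto
    finally show ?thesis by (simp add: abs_mult mult_ac)
  qed
  have b_int: "set_integrable lborel {0<..} (b q)" if "q \<ge> 0" for q
    unfolding b_def using set_integrable_powr_exp_powr[of \<alpha> "\<alpha> + q" "Re s"] \<alpha> s that
    by (intro set_integrable_mult_right) auto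
  have f_le_b: "\<bar>f t\<bar> / t \<le> b 0 t" if "t > 0" for t
    using f_le[of t] that by (simp add: b_def powr_diff divide_simps mult_ac)
  show int: "set_integrable lborel {0<..} (\<lambda>t. Im (exp (- s * of_real (t powr \<alpha>))) / t)"
  proof (rule set_integrable_bound[OF b_int[of 0]])
    show "set_borel_measurable lborel {0<..} (\<lambda>t. Im (exp (- s * of_real (t powr \<alpha>))) / t)"
      unfolding set_borel_measurable_def by measurable
  qed (use f_le_b in \<open>auto simp: f_def abs_mult intro: order_trans[OF _ abs_ge_self]\<close>)
  have "(\<lambda>k. LBINT t:{0<..}. t powr (p k - 1) * f t) \<longlonglongrightarrow> (LBINT t:{0<..}. f t / t)"
    unfolding set_lebesgue_integral_def
  proof (rule integral_dominated_convergence)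
    show "integrable lborel (\<lambda>t. indicator {0<..} t *\<^sub>R (b 0 t + b 1 t))"
      using set_integral_add(1)[OF b_int[of 0] b_int[of 1]] by (simp add: set_integrable_def)
    show "AE t in lborel. (\<lambda>k. indicator {0<..} t *\<^sub>R (t powr (p k - 1) * f t))
            \<longlonglongrightarrow> indicator {0<..} t *\<^sub>R (f t / t)"
    proof (intro AE_I2)
      fix t :: real
      show "(\<lambda>k. indicator {0<..} t *\<^sub>R (t powr (p k - 1) * f t))
            \<longlonglongrightarrow> indicator {0<..} t *\<^sub>R (f t / t)"
      proof (cases "t > 0")
        case True
        have "(\<lambda>k. t powr (p k - 1)) \<longlonglongrightarrow> t powr (0 - 1)"
          using True p_lim by (intro tendsto_intros) (auto simp: filterlim_at)
        hence "(\<lambda>k. t powr (p k - 1) * f t) \<longlonglongrightarrow> t powr (0 - 1) * f t"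
          by (rule tendsto_mult_right)
        thus ?thesis using True by (simp add: powr_minus_divide)
      qed auto
    qed
    show "AE t in lborel. norm (indicator {0<..} t *\<^sub>R (t powr (p k - 1) * f t))
            \<le> indicator {0<..} t *\<^sub>R (b 0 t + b 1 t)" for k
    proof (intro AE_I2)
      fix t :: real
      show "norm (indicator {0<..} t *\<^sub>R (t powr (p k - 1) * f t)) \<le> indicator {0<..} t *\<^sub>R (b 0 t + b 1 t)"
      proof (cases "t > 0")
        case True
        \<comment> \<open>This bound is free of \<open>k\<close>, so \<open>b 0 + b 1\<close>
          dominates the whole sequence.\<close>
        have "t powr p k \<le> 1 + t"
        proof (cases "t \<le> 1")
          case le: True
          thus ?thesis using True p[of k] powr_le1[of "p k" t] by auto
        next
          case False
          thus ?thesis using True p[of k] powr_mono[of "p k" 1 t] by auto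
        qed
        hence "t powr p k * (\<bar>f t\<bar> / t) \<le> (1 + t) * b 0 t"
          using True f_le_b[OF True] by (intro mult_mono) auto
        also have "(1 + t) * b 0 t = b 0 t + b 1 t"
          using True by (simp add: b_def powr_diff powr_add field_simps)
        finally show ?thesis using True by (simp add: powr_diff abs_mult)
      qed auto
    qed
  qed (auto simp: f_def)
  moreover have "(\<lambda>k. LBINT t:{0<..}. t powr (p k - 1) * f t) \<longlonglongrightarrow> - Arg s / \<alpha>"
  proof -
    define c where "c = - Arg s / \<alpha>"
    \<comment> \<open>\<open>L q\<close> is the imaginary part of the Mellin transform with
      \<open>Gamma (q / \<alpha>) / \<alpha>\<close> rewritten as
      \<open>Gamma (1 + q / \<alpha>) / q\<close>. The pole then sits in
      \<open>sin (c * q) / q\<close>, whose limit at 0 is \<open>c\<close>.\<close>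
    define L where "L = (\<lambda>q. Gamma (1 + q / \<alpha>) * exp (- q / \<alpha> * ln (cmod s)) * (sin (c * q) / q))"
    have s0: "s \<noteq> 0" using s by auto
    have eq: "(LBINT t:{0<..}. t powr (q - 1) * f t) = L q" if "q > 0" for q
    proof -
      have "(LBINT t:{0<..}. t powr (q - 1) * f t) =
          (LBINT t:{0<..}. Im (of_real (t powr (q - 1)) * exp (- s * of_real (t powr \<alpha>))))"
        by (simp add: f_def)
      also have "\<dots> = Im (mellin_exp \<alpha> q s)"
        using integral_Im[OF set_integrable_powr_cexp_powr[OF \<alpha> that s, unfolded set_integrable_def]]
        unfolding mellin_exp_def set_lebesgue_integral_def by simp
      also have "\<dots> = Gamma (q / \<alpha>) / \<alpha> * Im (s powr of_real (- q / \<alpha>))"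
        by (simp only: mellin_exp_eq[OF \<alpha> that s]) simp
      also have "Im (s powr of_real (- q / \<alpha>)) = exp (- q / \<alpha> * ln (cmod s)) * sin (c * q)"
        using s0 by (simp add: powr_def Im_exp c_def Arg_def mult_ac)
      also have "Gamma (q / \<alpha>) / \<alpha> = Gamma (1 + q / \<alpha>) / q"
      proof -
        have "v \<notin> \<int>\<^sub>\<le>\<^sub>0" if "v > 0" for v :: real
          using that by (auto simp: nonpos_Ints_def)
        hence "Gamma (1 + q / \<alpha>) = q / \<alpha> * Gamma (q / \<alpha>)"
          using Gamma_plus1[of "q / \<alpha>"] \<open>q > 0\<close> \<alpha> by (simp add: add.commute)
        thus ?thesis using \<open>q > 0\<close> by simp
      qed
      finally show ?thesis by (simp add: L_def)
    qed
    have "((\<lambda>q. sin (c * q)) has_field_derivative c) (at 0)"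
      by (auto intro!: derivative_eq_intros)
    hence "((\<lambda>q. sin (c * q) / q) \<longlongrightarrow> c) (at 0)"
      by (simp add: has_field_derivative_iff)
    hence "(L \<longlongrightarrow> Gamma (1 + 0 / \<alpha>) * exp (- 0 / \<alpha> * ln (cmod s)) * c) (at 0)"
      unfolding L_def using \<alpha> by (intro tendsto_intros) (auto simp: nonpos_Ints_def)
    hence "(\<lambda>k. L (p k)) \<longlonglongrightarrow> c"
      using filterlim_compose[OF _ p_lim] by fastforce
    thus ?thesis using eq p by (simp add: c_def)
  qed
  ultimately show "(LBINT t:{0<..}. Im (exp (- s * of_real (t powr \<alpha>))) / t) = - Arg s / \<alpha>"
    unfolding f_def by (rule LIMSEQ_unique)
qed

section \<open>Growth of Gamma and termwise integration\<close>

text \<open>By log-convexity of Gamma: \<open>x + h\<close> is the convex combination of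
  \<open>x\<close> and \<open>x + 1\<close> with weights \<open>1 - h\<close> and \<open>h\<close>,
  and \<open>Gamma (x + 1) = x * Gamma x\<close>.\<close>

lemma Gamma_add_le_powr:
  fixes x h :: real
  assumes "x > 0" "0 \<le> h" "h \<le> 1"
  shows "Gamma (x + h) \<le> x powr h * Gamma x"
proof -
  have "(ln \<circ> Gamma) ((1 - h) *\<^sub>R x + h *\<^sub>R (x + 1)) \<le> (1 - h) * (ln \<circ> Gamma) x + h * (ln \<circ> Gamma) (x + 1)"
    using assms by (intro convex_onD[OF log_convex_Gamma_real]) auto
  moreover have "Gamma (x + 1) = x * Gamma x"
    using assms by (intro Gamma_plus1) (auto simp: nonpos_Ints_def)
  moreover have "Gamma x \<noteq> 0" using Gamma_real_pos[OF assms(1)] by simp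
  ultimately have "ln (Gamma (x + h)) \<le> ln (x powr h * Gamma x)"
    using assms by (simp add: algebra_simps ln_mult Gamma_real_pos ln_powr)
  thus ?thesis using assms by (subst (asm) ln_le_cancel_iff) (auto intro: Gamma_real_pos)
qed

text \<open>The ratio of consecutive terms is at most
  \<open>\<bar>z\<bar> * real n powr (1 / \<alpha> - 1)\<close> in modulus, and the exponent is
  negative because \<alpha> exceeds 1.\<close>

lemma summable_Gamma_divide_fact:
  fixes \<alpha> z :: real
  assumes "\<alpha> > 1"
  shows "summable (\<lambda>n. Gamma (real n / \<alpha>) / fact n * z ^ n)"
proof -
  have "((\<lambda>x::real. x powr (1 / \<alpha> - 1)) \<longlongrightarrow> 0) at_top"
    using assms by (intro tendsto_neg_powr) (auto simp: filterlim_ident)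
  hence "(\<lambda>n. \<bar>z\<bar> * real n powr (1 / \<alpha> - 1)) \<longlonglongrightarrow> \<bar>z\<bar> * 0"
    by (intro tendsto_intros filterlim_compose[OF _ filterlim_real_sequentially])
  hence "\<forall>\<^sub>F n in sequentially. \<bar>z\<bar> * real n powr (1 / \<alpha> - 1) < 1 / 2"
    by (rule order_tendstoD) auto
  then obtain N where N: "\<And>n. n \<ge> N \<Longrightarrow> \<bar>z\<bar> * real n powr (1 / \<alpha> - 1) < 1 / 2"
    by (auto simp: eventually_sequentially)
  show ?thesis
  \<comment> \<open>Starting at 1 or later keeps \<open>real n / \<alpha>\<close> positive, away
    from the pole of Gamma at 0.\<close>
  proof (rule summable_ratio_test[of "1/2" "max N 1"])
    fix n assume "n \<ge> max N 1"
    hence n: "n \<ge> N" "real n > 0" by auto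
    have n\<alpha>: "real n / \<alpha> > 0" using n assms by simp
    have "Gamma (real (Suc n) / \<alpha>) \<le> (real n / \<alpha>) powr (1 / \<alpha>) * Gamma (real n / \<alpha>)"
      using Gamma_add_le_powr[OF n\<alpha>, of "1 / \<alpha>"] assms by (simp add: add_divide_distrib add.commute)
    also have "(real n / \<alpha>) powr (1 / \<alpha>) \<le> real n powr (1 / \<alpha>)"
      using n assms by (intro powr_mono2) (auto simp: field_simps)
    also have "real n powr (1 / \<alpha>) = real n * real n powr (1 / \<alpha> - 1)"
      using n by (simp add: powr_diff)
    also have "\<dots> \<le> real (Suc n) * real n powr (1 / \<alpha> - 1)"
      by (intro mult_right_mono) auto
    finally have G: "Gamma (real (Suc n) / \<alpha>) \<le> real (Suc n) * real n powr (1 / \<alpha> - 1) * Gamma (real n / \<alpha>)"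
      using Gamma_real_pos[OF n\<alpha>] by simp
    have pos: "Gamma (real (Suc n) / \<alpha>) > 0" "Gamma (real n / \<alpha>) > 0"
      using n assms by (auto intro!: Gamma_real_pos simp: add_pos_pos)
    have "norm (Gamma (real (Suc n) / \<alpha>) / fact (Suc n) * z ^ Suc n) =
        Gamma (real (Suc n) / \<alpha>) * (\<bar>z\<bar> ^ Suc n / fact (Suc n))"
      using pos by (simp add: abs_mult power_abs del: fact_Suc of_nat_Suc)
    also have "\<dots> \<le> real (Suc n) * real n powr (1 / \<alpha> - 1) * Gamma (real n / \<alpha>) * (\<bar>z\<bar> ^ Suc n / fact (Suc n))"
      by (intro mult_right_mono G) auto
    also have "\<dots> = (\<bar>z\<bar> * real n powr (1 / \<alpha> - 1)) * (Gamma (real n / \<alpha>) / fact n * \<bar>z\<bar> ^ n)"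
      by (simp add: divide_simps del: of_nat_Suc)
    also have "\<dots> \<le> 1 / 2 * (Gamma (real n / \<alpha>) / fact n * \<bar>z\<bar> ^ n)"
      using N[OF n(1)] pos by (intro mult_right_mono) auto
    also have "\<dots> = 1 / 2 * norm (Gamma (real n / \<alpha>) / fact n * z ^ n)"
      using pos by (simp add: abs_mult power_abs)
    finally show "norm (Gamma (real (Suc n) / \<alpha>) / fact (Suc n) * z ^ Suc n)
        \<le> 1 / 2 * norm (Gamma (real n / \<alpha>) / fact n * z ^ n)" .
  qed simp
qed

text \<open>The series of \<open>iexp (t * y) - 1\<close> starts at order one, so division by
  \<open>t\<close> leaves Mellin integrands with positive exponents, integrated term by term. The
  subtracted 1 is the integral of vanishing exponent, which accounts for
  \<open>Arg s / \<alpha>\<close>.\<close>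

lemma set_integral_Im_iexp_cexp_powr_divide:
  fixes \<alpha> y :: real and s :: complex
  assumes \<alpha>: "\<alpha> > 1" and s: "Re s > 0"
  defines "f \<equiv> \<lambda>t. Im (iexp (t * y) * exp (- s * of_real (t powr \<alpha>))) / t"
  defines "A \<equiv> \<lambda>n. Im ((\<i> * of_real y) ^ Suc n / fact (Suc n) * mellin_exp \<alpha> (real (Suc n)) s)"
  shows "set_integrable lborel {0<..} f"
    and "A sums ((LBINT t:{0<..}. f t) + Arg s / \<alpha>)"
proof -
  have \<alpha>0: "\<alpha> > 0" using \<alpha> by simp
  \<comment> \<open>For positive \<open>t\<close> the power is \<open>t ^ n\<close>: the power
    \<open>t ^ Suc n\<close> of the exponential series after division by \<open>t\<close>.\<close>
  define h where "h = (\<lambda>n t. of_real (t powr (real (Suc n) - 1)) * exp (- s * of_real (t powr \<alpha>)))"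
  define C where "C = (\<lambda>n. (\<i> * of_real y) ^ Suc n / fact (Suc n))"
  define g where "g = (\<lambda>n t. indicator {0<..} t *\<^sub>R Im (C n * h n t))"
  define g0 where "g0 = (\<lambda>t. Im (exp (- s * of_real (t powr \<alpha>))) / t)"
  have h_int: "integrable lborel (\<lambda>t. indicator {0<..} t *\<^sub>R h n t)" for n
    using set_integrable_powr_cexp_powr[OF \<alpha>0 _ s, of "real (Suc n)"]
    unfolding h_def set_integrable_def by simp
  hence Ch_int: "integrable lborel (\<lambda>t. C n * (indicator {0<..} t *\<^sub>R h n t))" for n
    by (intro integrable_mult_right)
  have g_eq: "g n = (\<lambda>t. Im (C n * (indicator {0<..} t *\<^sub>R h n t)))" for n
    by (auto simp: g_def fun_eq_iff indicator_def)
  have g_int: "integrable lborel (g n)" for n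
    unfolding g_eq using Ch_int by (rule integrable_Im)
  have g_integral: "integral\<^sup>L lborel (g n) = A n" for n
  proof -
    have "integral\<^sup>L lborel (g n) = Im (\<integral>t. C n * (indicator {0<..} t *\<^sub>R h n t) \<partial>lborel)"
      unfolding g_eq using Ch_int by (rule integral_Im)
    also have "\<dots> = A n"
      unfolding A_def C_def h_def mellin_exp_def set_lebesgue_integral_def
      by (subst integral_mult_right_zero) (rule refl)
    finally show ?thesis .
  qed
  have g_sums: "(\<lambda>n. g n t) sums (indicator {0<..} t *\<^sub>R (f t - g0 t))" for t
  proof (cases "t > 0")
    case True
    have "(\<lambda>n. (\<i> * of_real (t * y)) ^ n /\<^sub>R fact n) sums exp (\<i> * of_real (t * y))"
      by (rule exp_converges)
    hence "(\<lambda>n. (\<i> * of_real (t * y)) ^ Suc n /\<^sub>R fact (Suc n)) sums (exp (\<i> * of_real (t * y)) - 1)"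
      by (subst sums_Suc_iff) simp
    hence "(\<lambda>n. Im ((\<i> * of_real (t * y)) ^ Suc n /\<^sub>R fact (Suc n) * (exp (- s * of_real (t powr \<alpha>)) / of_real t)))
       sums Im ((exp (\<i> * of_real (t * y)) - 1) * (exp (- s * of_real (t powr \<alpha>)) / of_real t))"
      by (intro sums_Im sums_mult2)
    also have "(exp (\<i> * of_real (t * y)) - 1) * (exp (- s * of_real (t powr \<alpha>)) / of_real t) =
        exp (\<i> * of_real (t * y)) * exp (- s * of_real (t powr \<alpha>)) / of_real t -
        exp (- s * of_real (t powr \<alpha>)) / of_real t"
      by (simp only: left_diff_distrib times_divide_eq_right mult_1_left diff_divide_distrib)
    also have "Im \<dots> = f t - g0 t"
      by (simp only: f_def g0_def minus_complex.sel Im_divide_of_real)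
    also have "(\<lambda>n. Im ((\<i> * of_real (t * y)) ^ Suc n /\<^sub>R fact (Suc n) * (exp (- s * of_real (t powr \<alpha>)) / of_real t)))
        = (\<lambda>n. g n t)"
    proof
      fix n
      have "(\<i> * of_real (t * y)) ^ Suc n /\<^sub>R fact (Suc n) * (exp (- s * of_real (t powr \<alpha>)) / of_real t) = C n * h n t"
        using True by (simp add: C_def h_def powr_realpow scaleR_conv_of_real power_mult_distrib divide_simps
            del: fact_Suc)
      thus "Im ((\<i> * of_real (t * y)) ^ Suc n /\<^sub>R fact (Suc n) * (exp (- s * of_real (t powr \<alpha>)) / of_real t)) = g n t"
        using True by (simp add: g_def)
    qed
    finally show ?thesis using True by simp
  qed (simp add: g_def)
  \<comment> \<open>The majorant replaces \<open>s\<close> by its real part, so its integral is a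
    real Mellin transform and the integrals form a series covered by
    \<open>summable_Gamma_divide_fact\<close>.\<close>
  define b where "b = (\<lambda>n t. \<bar>y\<bar> ^ Suc n / fact (Suc n) * (indicator {0<..} t *\<^sub>R
      (t powr (real (Suc n) - 1) * exp (- Re s * t powr \<alpha>))))"
  have b_int: "integrable lborel (b n)" for n
    unfolding b_def using set_integrable_powr_exp_powr[OF \<alpha>0 _ s, of "real (Suc n)"]
    by (intro integrable_mult_right) (auto simp: set_integrable_def)
  have g_le_b: "norm (g n t) \<le> b n t" for n t
  proof -
    have "\<bar>Im (C n * h n t)\<bar> \<le> cmod (C n * h n t)" by (rule abs_Im_le_cmod)
    also have "\<dots> = \<bar>y\<bar> ^ Suc n / fact (Suc n) * (t powr (real (Suc n) - 1) * exp (- Re s * t powr \<alpha>))"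
      by (simp add: C_def h_def norm_mult norm_divide norm_power del: fact_Suc power_Suc)
    finally show ?thesis by (auto simp: g_def b_def indicator_def)
  qed
  have b_integral: "integral\<^sup>L lborel (b n) =
      Gamma (real (Suc n) / \<alpha>) / fact (Suc n) * (\<bar>y\<bar> * Re s powr (- 1 / \<alpha>)) ^ Suc n / \<alpha>" for n
  proof -
    have "integral\<^sup>L lborel (b n) = \<bar>y\<bar> ^ Suc n / fact (Suc n) *
        (Gamma (real (Suc n) / \<alpha>) / \<alpha> * Re s powr (- real (Suc n) / \<alpha>))"
      using set_integral_powr_exp_powr[OF \<alpha>0 _ s, of "real (Suc n)"]
      unfolding b_def by (simp add: set_lebesgue_integral_def)
    also have "Re s powr (- real (Suc n) / \<alpha>) = (Re s powr (- 1 / \<alpha>)) ^ Suc n"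
      using s by (simp only: powr_realpow[symmetric] powr_gt_zero powr_powr) (simp del: of_nat_Suc)
    finally show ?thesis by (simp add: power_mult_distrib)
  qed
  have summ: "summable (\<lambda>n. integral\<^sup>L lborel (b n))"
    unfolding b_integral
    using summable_Gamma_divide_fact[OF \<alpha>] by (intro summable_divide) (subst summable_Suc_iff)
  have 1: "AE t in lborel. summable (\<lambda>n. norm (g n t))"
  proof (intro AE_I2)
    fix t :: real
    show "summable (\<lambda>n. norm (g n t))"
    proof (cases "t > 0")
      case True
      have "summable (\<lambda>n. \<bar>t * y\<bar> ^ n /\<^sub>R fact n)" by (rule summable_exp_generic)
      hence "summable (\<lambda>n. \<bar>t * y\<bar> ^ Suc n /\<^sub>R fact (Suc n) * (exp (- Re s * t powr \<alpha>) / t))"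
        by (intro summable_mult2) (subst summable_Suc_iff)
      \<comment> \<open>For fixed \<open>t\<close> the majorants are terms of the exponential series
        of \<open>\<bar>t * y\<bar>\<close>, times a factor independent of \<open>n\<close>.\<close>
      moreover have "b n t = \<bar>t * y\<bar> ^ Suc n /\<^sub>R fact (Suc n) * (exp (- Re s * t powr \<alpha>) / t)" for n
      proof -
        have regroup: "Y / F * (T * E) = (t * T * Y) /\<^sub>R F * (E / t)" for Y F T E :: real
          using True by (cases "F = 0") (simp_all add: field_simps)
        have "t powr (real (Suc n) - 1) = t ^ n"
          using True by (simp add: powr_realpow)
        hence "b n t = \<bar>y\<bar> ^ Suc n / fact (Suc n) * (t ^ n * exp (- Re s * t powr \<alpha>))"
          using True by (simp add: b_def del: fact_Suc power_Suc)
        also have "\<dots> = (t * t ^ n * \<bar>y\<bar> ^ Suc n) /\<^sub>R fact (Suc n) * (exp (- Re s * t powr \<alpha>) / t)"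
          by (rule regroup)
        also have "t * t ^ n * \<bar>y\<bar> ^ Suc n = \<bar>t * y\<bar> ^ Suc n"
          using True by (simp add: abs_mult power_mult_distrib mult_ac)
        finally show ?thesis .
      qed
      ultimately have "summable (\<lambda>n. b n t)" by (simp only:)
      thus ?thesis
        by (rule summable_comparison_test'[of _ 0]) (simp only: real_norm_def abs_abs g_le_b[unfolded real_norm_def])
    qed (simp add: g_def)
  qed
  have 2: "summable (\<lambda>n. \<integral>t. norm (g n t) \<partial>lborel)"
  proof (rule summable_comparison_test'[OF summ, of 0])
    fix n
    have "(\<integral>t. norm (g n t) \<partial>lborel) \<le> integral\<^sup>L lborel (b n)"
      using g_int b_int g_le_b by (intro integral_mono) auto
    thus "norm (\<integral>t. norm (g n t) \<partial>lborel) \<le> integral\<^sup>L lborel (b n)" by simp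
  qed
  have suminf_eq: "(\<lambda>t. \<Sum>n. g n t) = (\<lambda>t. indicator {0<..} t *\<^sub>R (f t - g0 t))"
    using g_sums by (simp add: sums_iff)
  \<comment> \<open>Termwise integration reaches only the difference \<open>f - g0\<close>; adding
    back the integrable \<open>g0\<close> recovers \<open>f\<close>.\<close>
  have diff_int: "set_integrable lborel {0<..} (\<lambda>t. f t - g0 t)"
    using integrable_suminf[OF g_int 1 2] by (simp add: suminf_eq set_integrable_def)
  have g0: "set_integrable lborel {0<..} g0" "(LBINT t:{0<..}. g0 t) = - Arg s / \<alpha>"
    unfolding g0_def using set_integral_Im_cexp_powr_divide[OF \<alpha>0 s] by auto
  show f_int: "set_integrable lborel {0<..} f"
    using set_integral_add(1)[OF diff_int g0(1)] by simp
  have "A sums (LBINT t:{0<..}. f t - g0 t)"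
    using sums_integral[OF g_int 1 2] by (simp add: g_integral suminf_eq set_lebesgue_integral_def)
  thus "A sums ((LBINT t:{0<..}. f t) + Arg s / \<alpha>)"
    using set_integral_diff(2)[OF f_int g0(1)] g0(2) by simp
qed

section \<open>Reflection formula, atoms and the stable tail series\<close>

text \<open>This is Euler's reflection formula, restricted from the complex numbers. With
  \<open>rGamma\<close> it covers positive integers \<open>x\<close> too, where both sides
  vanish.\<close>

lemma Gamma_mult_sin_eq_rGamma:
  fixes x :: real
  assumes "x > 0"
  shows "Gamma x * sin (pi * x) = pi * rGamma (1 - x)"
proof -
  have "complex_of_real (rGamma x * rGamma (1 - x)) = rGamma (of_real x) * rGamma (1 - of_real x)"
    by (simp only: of_real_mult rGamma_complex_of_real[symmetric] of_real_diff of_real_1)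
  also have "\<dots> = sin (of_real pi * of_real x) / of_real pi"
    by (rule rGamma_reflection_complex)
  also have "\<dots> = of_real (sin (pi * x) / pi)"
    by (simp only: of_real_divide sin_of_real[symmetric] of_real_mult)
  finally have "complex_of_real (rGamma x * rGamma (1 - x)) = of_real (sin (pi * x) / pi)" .
  hence "rGamma x * rGamma (1 - x) = sin (pi * x) / pi"
    by (simp only: of_real_eq_iff)
  moreover have "Gamma x * rGamma x = 1"
    using Gamma_real_pos[OF assms] by (simp add: rGamma_inverse_Gamma)
  ultimately have "Gamma x * (sin (pi * x) / pi) = rGamma (1 - x)"
    by (metis mult.assoc mult_1_left)
  thus ?thesis by (simp add: field_simps)
qed

context real_distribution
begin

text \<open>An atom at \<open>y\<close> belongs to the upper tail at \<open>x\<close> but not to the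
  one at \<open>y\<close>, so it forces a downward jump of the tail difference.\<close>

lemma prob_singleton_le_tail_difference:
  assumes "x < y"
  shows "prob {y} \<le> (prob {x<..} - prob {..<x}) - (prob {y<..} - prob {..<y})"
proof -
  have "prob {y<..} + prob {y} = prob ({y<..} \<union> {y})"
    by (rule finite_measure_Union[symmetric]) auto
  also have "\<dots> \<le> prob {x<..}" using assms by (intro finite_measure_mono) auto
  finally have "prob {y<..} + prob {y} \<le> prob {x<..}" .
  moreover have "prob {..<x} \<le> prob {..<y}"
    using assms by (intro finite_measure_mono) auto
  ultimately show ?thesis by linarith
qed

text \<open>Continuity of the tail difference rules out an atom at \<open>x\<close>. The two strict
  tails then add up to 1, and the difference determines each.\<close>

lemma prob_greaterThan_eq:
  assumes cont: "isCont (\<lambda>x. prob {x<..} - prob {..<x}) x"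
  shows "prob {x<..} = (1 + (prob {x<..} - prob {..<x})) / 2"
proof -
  define D where "D = (\<lambda>x. prob {x<..} - prob {..<x})"
  \<comment> \<open>Approaching \<open>x\<close> strictly from the left squeezes the mass of
    \<open>{x}\<close> below a difference that tends to 0.\<close>
  have "(\<lambda>n. x - 1 / real (Suc n)) \<longlonglongrightarrow> x - 0"
    using LIMSEQ_inverse_real_of_nat by (intro tendsto_intros) (simp add: inverse_eq_divide)
  hence "(\<lambda>n. D (x - 1 / real (Suc n)) - D x) \<longlonglongrightarrow> D x - D x"
    using cont unfolding D_def by (intro tendsto_diff[OF _ tendsto_const] isCont_tendsto_compose[OF cont]) simp
  hence "prob {x} \<le> D x - D x"
    by (rule LIMSEQ_le_const) (auto simp: D_def intro!: prob_singleton_le_tail_difference)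
  hence "prob {x} = 0" by (simp add: measure_le_0_iff)
  moreover have "prob ({x<..} \<union> {x}) = prob {x<..} + prob {x}"
    by (rule finite_measure_Union) auto
  moreover have "prob ({x<..} \<union> {x} \<union> {..<x}) = prob ({x<..} \<union> {x}) + prob {..<x}"
    by (rule finite_measure_Union) auto
  moreover have "{x<..} \<union> {x} \<union> {..<x} = (UNIV :: real set)" by auto
  moreover have "prob UNIV = 1" using prob_space by simp
  ultimately show ?thesis by simp
qed

end

text \<open>The phase \<open>n * pi / 2\<close> of \<open>\<i> ^ n\<close> cancels against part of
  the phase of \<open>s powr (- n / \<alpha>)\<close> and leaves \<open>pi * n / \<alpha>\<close>;
  its sine meets \<open>Gamma (n / \<alpha>)\<close> in the reflection formula.\<close>

lemma Im_mellin_exp_eq_rGamma: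
  fixes \<alpha> c y :: real and n :: nat
  assumes \<alpha>: "1 < \<alpha>" "\<alpha> \<le> 2" and c: "c > 0" and n: "n > 0"
  defines "s \<equiv> of_real c * cis (pi * \<alpha> / 2 - pi)"
  shows "Im ((\<i> * of_real y) ^ n / fact n * mellin_exp \<alpha> (real n) s) =
           pi / \<alpha> * (rGamma (1 - real n / \<alpha>) / fact n * y ^ n * c powr (- real n / \<alpha>))"
proof -
  define \<theta> where "\<theta> = pi * \<alpha> / 2 - pi"
  have \<theta>: "- pi / 2 < \<theta>" "\<theta> \<le> 0" using \<alpha> by (auto simp: \<theta>_def field_simps)
  have s: "s = of_real c * cis \<theta>" by (simp add: s_def \<theta>_def)
  have Re_s: "Re s > 0"
    using \<theta> c pi_gt_zero by (auto simp: s intro!: mult_pos_pos cos_gt_zero_pi)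
  \<comment> \<open>The angle \<theta> lies in the principal range, so the complex power of
    \<open>s\<close> can be written out in polar form.\<close>
  have Ln_s: "Ln s = of_real (ln c) + \<i> * of_real \<theta>"
  proof (rule Ln_unique)
    show "exp (of_real (ln c) + \<i> * of_real \<theta>) = s"
      using c by (simp add: s exp_add cis_conv_exp exp_of_real flip: of_real_exp)
  qed (use \<theta> pi_gt_zero in auto)
  define q where "q = real n / \<alpha>"
  have q: "q > 0" using n \<alpha> by (simp add: q_def)
  have "s powr of_real (- q) = exp (of_real (- q * ln c) + \<i> * of_real (- q * \<theta>))"
    using Re_s by (auto simp: powr_def Ln_s algebra_simps)
  also have "\<dots> = of_real (c powr (- q)) * cis (- q * \<theta>)"
    using c by (simp only: exp_add exp_of_real cis_conv_exp) (simp add: powr_def)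
  finally have s_powr: "s powr of_real (- q) = of_real (c powr (- q)) * cis (- q * \<theta>)" .
  have "\<i> ^ n = cis (real n * (pi / 2))"
    unfolding Complex.DeMoivre[symmetric] by simp
  hence "\<i> ^ n * cis (- q * \<theta>) = cis (real n * (pi / 2) + - q * \<theta>)"
    by (simp only: cis_mult)
  also have "real n * (pi / 2) + - q * \<theta> = pi * q"
    using \<alpha> by (simp add: q_def \<theta>_def field_simps)
  finally have i_cis: "\<i> ^ n * cis (- q * \<theta>) = cis (pi * q)" .
  have "(\<i> * of_real y) ^ n / fact n * mellin_exp \<alpha> (real n) s =
      (\<i> * of_real y) ^ n / fact n * (of_real (Gamma q / \<alpha>) * (of_real (c powr (- q)) * cis (- q * \<theta>)))"
    using mellin_exp_eq[of \<alpha> "real n" s] \<alpha> n Re_s s_powr by (simp add: q_def)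
  also have "\<dots> = of_real (y ^ n / fact n * (Gamma q / \<alpha>) * c powr (- q)) * (\<i> ^ n * cis (- q * \<theta>))"
    by (simp add: power_mult_distrib mult_ac)
  also have "Im \<dots> = y ^ n / fact n * (Gamma q / \<alpha>) * c powr (- q) * sin (pi * q)"
    unfolding i_cis by (simp only: times_complex.sel Re_complex_of_real Im_complex_of_real cis.sel)
  also have "\<dots> = y ^ n / fact n / \<alpha> * c powr (- q) * (Gamma q * sin (pi * q))"
    by simp
  also have "\<dots> = pi / \<alpha> * (rGamma (1 - q) / fact n * y ^ n * c powr (- q))"
    by (simp only: Gamma_mult_sin_eq_rGamma[OF q] divide_inverse ac_simps)
  finally show ?thesis by (simp add: q_def)
qed

text \<open>Gil-Pelaez inversion gives the tail difference as an everywhere convergent power series.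
  Such a series is continuous, so there are no atoms and the tail itself follows.\<close>

lemma (in real_distribution) stable_tail_series:
  fixes \<alpha> c :: real
  assumes \<alpha>: "1 < \<alpha>" "\<alpha> \<le> 2" and c: "c > 0"
  assumes char: "\<And>t. t > 0 \<Longrightarrow>
     char M t = exp (- (of_real c * cis (pi * \<alpha> / 2 - pi)) * of_real (t powr \<alpha>))"
  shows "(\<lambda>n. rGamma (1 - real n / \<alpha>) / fact n * y ^ n * c powr (- real n / \<alpha>)) sums (\<alpha> * prob {- y<..})"
proof -
  define s where "s = of_real c * cis (pi * \<alpha> / 2 - pi)"
  define \<theta> where "\<theta> = pi * \<alpha> / 2 - pi"
  have \<theta>: "- pi / 2 < \<theta>" "\<theta> \<le> 0" using \<alpha> by (auto simp: \<theta>_def field_simps)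
  have s: "s = of_real c * cis \<theta>" by (simp add: s_def \<theta>_def)
  have Re_s: "Re s > 0"
    using \<theta> c pi_gt_zero by (auto simp: s intro!: mult_pos_pos cos_gt_zero_pi)
  have Arg_s: "Arg s = \<theta>"
    using \<theta> c pi_gt_zero unfolding s by (intro Arg_unique[of c]) (auto simp: cis_conv_exp)
  define a where "a = (\<lambda>n. rGamma (1 - real n / \<alpha>) / fact n * c powr (- real n / \<alpha>))"
  define D where "D = (\<lambda>x. prob {x<..} - prob {..<x})"
  have a0: "a 0 = 1" using c by (simp add: a_def)
  \<comment> \<open>This is proved for every \<open>y\<close>, not just the given one: continuity
    needs the expansion of \<open>D\<close> as a function.\<close>
  have D: "(\<lambda>n. a n * y ^ n) sums (\<alpha> * (1 + D (- y)) / 2)" for y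
  proof -
    define f where "f = (\<lambda>t. Im (iexp (t * y) * exp (- s * of_real (t powr \<alpha>))) / t)"
    have f_eq: "Im (iexp (- (t * (- y))) * char M t) / t = f t" if "t \<in> {0<..}" for t
      using that char by (simp add: f_def s_def)
    have "set_integrable lborel {0<..} f"
      unfolding f_def by (rule set_integral_Im_iexp_cexp_powr_divide(1)[OF \<alpha>(1) Re_s])
    hence "set_integrable lborel {0<..} (\<lambda>t. Im (iexp (- (t * (- y))) * char M t) / t)"
      using f_eq by (subst set_integrable_cong[OF refl refl]) auto
    hence "D (- y) = 2 / pi * (LBINT t:{0<..}. Im (iexp (- (t * (- y))) * char M t) / t)"
      unfolding D_def by (rule gil_pelaez)
    also have "(LBINT t:{0<..}. Im (iexp (- (t * (- y))) * char M t) / t) = (LBINT t:{0<..}. f t)"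
      using f_eq by (intro set_lebesgue_integral_cong) auto
    finally have D_eq: "(LBINT t:{0<..}. f t) = pi / 2 * D (- y)"
      by (simp add: field_simps)
    have "(\<lambda>n. Im ((\<i> * of_real y) ^ Suc n / fact (Suc n) * mellin_exp \<alpha> (real (Suc n)) s))
        sums ((LBINT t:{0<..}. f t) + Arg s / \<alpha>)"
      unfolding f_def by (rule set_integral_Im_iexp_cexp_powr_divide(2)[OF \<alpha>(1) Re_s])
    also have "(\<lambda>n. Im ((\<i> * of_real y) ^ Suc n / fact (Suc n) * mellin_exp \<alpha> (real (Suc n)) s))
        = (\<lambda>n. pi / \<alpha> * (a (Suc n) * y ^ Suc n))"
      using Im_mellin_exp_eq_rGamma[OF \<alpha> c, of "Suc n" for n, folded s_def]
      by (simp only: a_def zero_less_Suc mult_ac)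
    finally have "(\<lambda>n. \<alpha> / pi * (pi / \<alpha> * (a (Suc n) * y ^ Suc n)))
        sums (\<alpha> / pi * (pi / 2 * D (- y) + \<theta> / \<alpha>))"
      unfolding D_eq Arg_s by (rule sums_mult)
    also have "(\<lambda>n. \<alpha> / pi * (pi / \<alpha> * (a (Suc n) * y ^ Suc n))) = (\<lambda>n. a (Suc n) * y ^ Suc n)"
      using \<alpha> by simp
    \<comment> \<open>Here \<open>\<theta> / pi = \<alpha> / 2 - 1\<close>: the argument of
      \<open>s\<close> contributes the constant \<alpha>/2 and the missing term of index 0, which is
      1.\<close>
    also have "\<alpha> / pi * (pi / 2 * D (- y) + \<theta> / \<alpha>) = \<alpha> * (1 + D (- y)) / 2 - a 0 * y ^ 0"
      using \<alpha> by (simp add: a0 \<theta>_def field_simps)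
    finally show ?thesis using sums_Suc_iff[of "\<lambda>n. a n * y ^ n"] by auto
  qed
  have "D = (\<lambda>x. 2 / \<alpha> * (\<Sum>n. a n * (- x) ^ n) - 1)"
  proof
    fix x
    have "(\<Sum>n. a n * (- x) ^ n) = \<alpha> * (1 + D x) / 2"
      using D[of "- x"] by (simp add: sums_iff)
    thus "D x = 2 / \<alpha> * (\<Sum>n. a n * (- x) ^ n) - 1"
      using \<alpha> by (simp add: field_simps)
  qed
  moreover have "isCont (\<lambda>x. \<Sum>n. a n * (- x) ^ n) (- y)"
  proof (rule isCont_o2[where g = "\<lambda>x. \<Sum>n. a n * x ^ n" and f = uminus])
    show "isCont (\<lambda>x. \<Sum>n. a n * x ^ n) (- (- y))"
      using D by (intro isCont_powser_converges_everywhere) (rule sums_summable)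
  qed simp
  ultimately have "isCont D (- y)"
    using \<alpha> by (simp only:) (intro continuous_intros; simp)
  hence "prob {- y<..} = (1 + D (- y)) / 2"
    unfolding D_def by (rule prob_greaterThan_eq)
  hence "(\<lambda>n. a n * y ^ n) sums (\<alpha> * prob {- y<..})"
    using D[of y] by (simp only: times_divide_eq_right)
  thus ?thesis by (simp add: a_def mult_ac)
qed

section \<open>The option value as a discounted stable tail\<close>

theorem proposition2:
  fixes M :: "'a measure" and X :: "real \<Rightarrow> 'a \<Rightarrow> real"
    and \<alpha> \<sigma> u S K r \<tau> \<mu> k\<^sub>u :: real
  assumes "1 < \<alpha>" "\<alpha> \<le> 2" "\<sigma> > 0" "u > 0" "S > 0" "K > 0" "\<tau> > 0"
    and "spectrally_negative_stable_process M \<alpha> \<sigma> X"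
    and "\<mu> = \<sigma> powr \<alpha> / cos (pi * \<alpha> / 2)"
    and "k\<^sub>u = ln (S / K powr (1 / u)) + r * \<tau>"
  shows "summable (\<lambda>n. rGamma (1 - real n / \<alpha>) / fact n *
             (k\<^sub>u + \<mu> * \<tau>) ^ n * (- \<mu> * \<tau>) powr (- real n / \<alpha>)) \<and>
         option_value M X (digital_power_cash_or_nothing_call u) S K r \<mu> \<tau> =
           exp (- r * \<tau>) / \<alpha> *
           (\<Sum>n. rGamma (1 - real n / \<alpha>) / fact n *
             (k\<^sub>u + \<mu> * \<tau>) ^ n * (- \<mu> * \<tau>) powr (- real n / \<alpha>))"
proof -
  interpret prob_space M
    using assms(8) by (simp add: spectrally_negative_stable_process_def levy_process_def)
  have [measurable]: "X \<tau> \<in> borel_measurable M"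
    using assms(7,8) by (simp add: spectrally_negative_stable_process_def levy_process_def)
  define N where "N = distr M borel (X \<tau>)"
  interpret N: real_distribution N
    unfolding N_def by (rule real_distribution_distr) measurable
  define c where "c = - \<mu> * \<tau>"
  \<comment> \<open>Subtracting pi moves the angle \<open>pi * \<alpha> / 2\<close> into the range
    where the cosine is positive; the sign change makes \<open>c\<close> positive.\<close>
  define \<theta> where "\<theta> = pi * \<alpha> / 2 - pi"
  define y where "y = k\<^sub>u + \<mu> * \<tau>"
  have \<theta>: "- pi / 2 < \<theta>" "\<theta> \<le> 0" using assms(1,2) by (auto simp: \<theta>_def field_simps)
  have cos_pos: "cos \<theta> > 0"
    using \<theta> pi_gt_zero by (intro cos_gt_zero_pi) auto
  have cos_eq: "cos (pi * \<alpha> / 2) = - cos \<theta>" and sin_eq: "sin (pi * \<alpha> / 2) = - sin \<theta>"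
    by (simp_all add: \<theta>_def cos_diff sin_diff)
  have c_eq: "c = \<tau> * \<sigma> powr \<alpha> / cos \<theta>"
    by (simp add: c_def assms(9) cos_eq)
  have c: "c > 0" using assms(3,7) cos_pos by (simp add: c_eq)
  have char: "char N t = exp (- (of_real c * cis (pi * \<alpha> / 2 - pi)) * of_real (t powr \<alpha>))" if "t > 0" for t
  proof -
    \<comment> \<open>The cosine in \<open>c\<close> turns \<open>cis \<theta>\<close> into
      \<open>1 + \<i> * tan \<theta>\<close>, and the tangent has period pi.\<close>
    have "of_real c * cis \<theta> = of_real (\<tau> * \<sigma> powr \<alpha>) * (1 + \<i> * of_real (tan (\<alpha> * pi / 2)))"
      using cos_pos by (simp add: complex_eq_iff c_eq tan_def mult.commute[of \<alpha>] cos_eq sin_eq)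
    moreover have "char N t = exp (- complex_of_real (\<tau> * \<sigma> powr \<alpha> * \<bar>t\<bar> powr \<alpha>) *
             (1 + \<i> * complex_of_real (tan (\<alpha> * pi / 2) * sgn t)))"
      using assms(7,8) by (simp add: N_def spectrally_negative_stable_process_def)
    ultimately show ?thesis using that by (simp add: \<theta>_def[symmetric] mult_ac)
  qed
  \<comment> \<open>Taking logarithms and dividing by the positive \<open>u\<close> puts the
    exercise threshold for \<open>X \<tau>\<close> at \<open>- y\<close>.\<close>
  have in_money: "terminal_price X S r \<mu> \<tau> \<omega> powr u - K > 0 \<longleftrightarrow> X \<tau> \<omega> \<in> {- y<..}" for \<omega>
  proof -
    have "terminal_price X S r \<mu> \<tau> \<omega> powr u = exp (u * (ln S + (r + \<mu>) * \<tau> + X \<tau> \<omega>))"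
      using assms(5) by (simp add: terminal_price_def powr_def ln_mult)
    also have "\<dots> > K \<longleftrightarrow> u * (ln S + (r + \<mu>) * \<tau> + X \<tau> \<omega>) > ln K"
      using assms(6) by (metis exp_less_cancel_iff exp_ln)
    also have "\<dots> \<longleftrightarrow> ln S + (r + \<mu>) * \<tau> + X \<tau> \<omega> > ln K / u"
      using assms(4) by (simp add: field_simps)
    also have "ln K / u = ln S + (r + \<mu>) * \<tau> - y"
      using assms(4-6) by (simp add: y_def assms(10) ln_div ln_powr algebra_simps)
    finally show ?thesis by auto
  qed
  have "expectation (\<lambda>\<omega>. digital_power_cash_or_nothing_call u (terminal_price X S r \<mu> \<tau> \<omega>) K)
      = expectation (\<lambda>\<omega>. indicator {- y<..} (X \<tau> \<omega>))"
    unfolding digital_power_cash_or_nothing_call_def in_money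
    by (intro Bochner_Integration.integral_cong) (auto simp: indicator_def)
  also have "\<dots> = (\<integral>x. indicator {- y<..} x \<partial>N)"
    unfolding N_def by (rule integral_distr[symmetric]) measurable
  also have "\<dots> = N.prob {- y<..}"
    by simp
  finally have "option_value M X (digital_power_cash_or_nothing_call u) S K r \<mu> \<tau> =
      exp (- r * \<tau>) * N.prob {- y<..}"
    by (simp add: option_value_def)
  moreover have "(\<lambda>n. rGamma (1 - real n / \<alpha>) / fact n * y ^ n * c powr (- real n / \<alpha>))
      sums (\<alpha> * N.prob {- y<..})"
    using assms(1,2) c char by (rule N.stable_tail_series)
  ultimately show ?thesis
    using assms(1) unfolding y_def[symmetric] c_def[symmetric] by (auto simp: sums_iff)
qed

end
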